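(* Let $g\in\mathfrak F_*$ and assume that $g$ has the strong natural-measure property (SNM). Let $\mathbf a=(a_k)_{k\ge0}$ be any strictly increasing sequence of nonnegative integers and let $\lambda\ll m$ be a Borel probability measure on $I$. Then the annealed sparse empirical measures $$\overline\mu_{n,\lambda}^{\mathbf a}=\int_I\Big(\frac1n\sum_{k=0}^{n-1}\delta_{g^{a_k}x}\Big)\,d\lambda(x)=\frac1n\sum_{k=0}^{n-1}(g^{a_k})_*\lambda$$ converge weak-star to $\nu_*$ as $n\to\infty$.
   Context: Strong natural-measure property (SNM) of $g$: for every Borel probability measure $\lambda\ll m$ on $I$, $(g^n)_*\lambda\to\nu_*$ weak-star as $n\to\infty$, where $\nu_*$ is defined below. The class $\mathfrak F_*$. Let $I=[-1,1]$, $I_-=[-1,0]$, $I_+=[0,1]$, and let $m$ be normalized Lebesgue measure on $I$. For a map $g:I\to I$ write $g_-,g_+$ for its branches on $(-1,0)$ and $(0,1)$, and also for their one-sided continuous extensions (so $g_-(0)=1$, $g_+(0)=-1$); the value $g(0)$ is by convention one of these two branch values. Then $g\in\mathfrak F_*$ if the following hold. (A0) $g_-:(-1,0)\to(-1,1)$ and $g_+:(0,1)\to(-1,1)$ are orientation-preserving $C^2$ diffeomorphisms, and the only fixed points of $g$ are $-1$ and $1$. (A1) There are constants $\ell_-,\ell_+,\iota,k_-,k_+,a_-,a_+,b_-,b_+>0$ such that, with $U_{0-}=(-\iota,0]$, $U_{0+}=[0,\iota)$, $U_{-1}=g_+(U_{0+})$, $U_{+1}=g_-(U_{0-})$: $g_-(x)=x+b_-(1+x)^{1+\ell_-}$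 on $U_{-1}$ and $g_+(x)=x-b_+(1-x)^{1+\ell_+}$ on $U_{+1}$; if $k_-\ne1$ then $g_-(x)=1-a_-|x|^{k_-}$ on $U_{0-}$; if $k_+\ne1$ then $g_+(x)=-1+a_+x^{k_+}$ on $U_{0+}$. If $k_-=1$ (resp. $k_+=1$), the corresponding formula is replaced by the requirement that the one-sided derivative satisfies $g'(0-)=a_->1$ (resp. $g'(0+)=a_+>1$), together with monotonicity on the corresponding one-sided neighborhood. (A2) Let $\Delta_0^-=g_-^{-1}((0,1))$, $\Delta_0^+=g_+^{-1}((-1,0))$, and for $n\ge1$ let $\Delta_n^\pm=g_\pm^{-1}(\Delta_{n-1}^\pm)$, $\delta_n^-=g_-^{-1}(\Delta_{n-1}^+)\cap\Delta_0^-$, $\delta_n^+=g_+^{-1}(\Delta_{n-1}^-)\cap\Delta_0^+$. Put $n_\pm=0$ if $\Delta_0^\pm\subset U_{0\pm}$, and otherwise $n_\pm=\min\{n\ge1:\delta_n^\pm\subset U_{0\pm}\}$. There is $\lambda_A>1$ such that, for either sign, $(g^n)'(x)>\lambda_A$ for all $1\le n\le n_\pm$ and $x\in\delta_n^\pm$ (empty requirement if $n_\pm=0$). (Balance) With $\beta^-=\ell_-k_+$, $\beta^+=\ell_+k_-$, one has $\beta^-=\beta^+=:\beta\ge1$. Put $\alpha=1/\beta\in(0,1]$. The measure $\nu_*$. Let $\varphi(u)=\min\{n\ge1:g^nu\in\Delta_0^-\}$ and $G(u)=g^{\varphi(u)}(u)$ be the first-return time and first-return map to $\Delta_0^-$ (defined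 Lebesgue-a.e. on $\Delta_0^-$). It is known that $G$ is a full-branch Gibbs--Markov map with a unique invariant probability $\widehat\mu$ on $\Delta_0^-$ absolutely continuous with respect to (in fact equivalent to) Lebesgue. Let $\tau^+(u)=\#\{1\le r\le\varphi(u):g^ru\in I_+\}$ and $\tau^-(u)=\#\{1\le r\le\varphi(u):g^ru\in I_-\}$. It is known that there are constants $C_+,C_->0$ with $\widehat\mu(\tau^\pm>n)\sim C_\pm n^{-\alpha}$. Put $p_*=C_+/(C_++C_-)$ and $\nu_*=p_*\delta_1+(1-p_* )\delta_{-1}$. *)

theory Defs
  imports "HOL-Probability.Probability" "HOL-Library.Landau_Symbols"
begin

section \<open>Measures on the interval and weak-star convergence\<close>

abbreviation I_borel :: "real measure" where
  "I_borel \<equiv> restrict_space borel {-1..1}"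

definition m_leb :: "real measure" where
  "m_leb = scale_measure (1/2) (restrict_space lborel {-1..1})"

definition borel_prob_I :: "real measure \<Rightarrow> bool" where
  "borel_prob_I \<rho> \<longleftrightarrow> prob_space \<rho> \<and> sets \<rho> = sets I_borel"

text \<open>Measures with the sigma-algebra of \<^term>\<open>I_borel\<close> have space \<open>[-1,1]\<close>, so only the
  restriction of the test function to \<open>[-1,1]\<close> enters the integrals.\<close>

definition weak_star_conv :: "(nat \<Rightarrow> real measure) \<Rightarrow> real measure \<Rightarrow> bool" where
  "weak_star_conv \<mu> \<nu> \<longleftrightarrow>
     (\<forall>f::real \<Rightarrow> real. continuous_on {-1..1} f \<longrightarrow>
        (\<lambda>n. \<integral>x. f x \<partial>\<mu> n) \<longlonglongrightarrow> (\<integral>x. f x \<partial>\<nu>))"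

definition lin_comb_measure ::
    "'a measure \<Rightarrow> 'i set \<Rightarrow> ('i \<Rightarrow> real) \<Rightarrow> ('i \<Rightarrow> 'a measure) \<Rightarrow> 'a measure" where
  "lin_comb_measure N J w M =
     measure_of (space N) (sets N) (\<lambda>A. \<Sum>i\<in>J. ennreal (w i) * emeasure (M i) A)"

section \<open>Branches, and the partition by first passage\<close>

text \<open>One-sided continuous extensions of the two branches to \<open>[-1,0]\<close> and \<open>[0,1]\<close>. For maps
  satisfying \<open>A0\<close> below, the limits at \<open>0\<close> are \<open>1\<close> and \<open>-1\<close>, whatever the value of \<open>g 0\<close>.\<close>

definition br_minus :: "(real \<Rightarrow> real) \<Rightarrow> real \<Rightarrow> real" where
  "br_minus g x = (if x = 0 then 1 else g x)"

definition br_plus :: "(real \<Rightarrow> real) \<Rightarrow> real \<Rightarrow> real" where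
  "br_plus g x = (if x = 0 then -1 else g x)"

primrec Delta_minus :: "(real \<Rightarrow> real) \<Rightarrow> nat \<Rightarrow> real set" where
  "Delta_minus g 0 = {x \<in> {-1..0}. br_minus g x \<in> {0<..<1}}"
| "Delta_minus g (Suc n) = {x \<in> {-1..0}. br_minus g x \<in> Delta_minus g n}"

primrec Delta_plus :: "(real \<Rightarrow> real) \<Rightarrow> nat \<Rightarrow> real set" where
  "Delta_plus g 0 = {x \<in> {0..1}. br_plus g x \<in> {-1<..<0}}"
| "Delta_plus g (Suc n) = {x \<in> {0..1}. br_plus g x \<in> Delta_plus g n}"

text \<open>The next two sets are only meaningful, and only used, for \<open>n \<ge> 1\<close>.\<close>

definition delta_minus :: "(real \<Rightarrow> real) \<Rightarrow> nat \<Rightarrow> real set" where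
  "delta_minus g n = {x \<in> {-1..0}. br_minus g x \<in> Delta_plus g (n - 1)} \<inter> Delta_minus g 0"

definition delta_plus :: "(real \<Rightarrow> real) \<Rightarrow> nat \<Rightarrow> real set" where
  "delta_plus g n = {x \<in> {0..1}. br_plus g x \<in> Delta_minus g (n - 1)} \<inter> Delta_plus g 0"

definition n_minus :: "(real \<Rightarrow> real) \<Rightarrow> real \<Rightarrow> nat" where
  "n_minus g \<iota> = (if Delta_minus g 0 \<subseteq> {-\<iota><..0} then 0
                  else (LEAST n. n \<ge> 1 \<and> delta_minus g n \<subseteq> {-\<iota><..0}))"

definition n_plus :: "(real \<Rightarrow> real) \<Rightarrow> real \<Rightarrow> nat" where
  "n_plus g \<iota> = (if Delta_plus g 0 \<subseteq> {0..<\<iota>} then 0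
                 else (LEAST n. n \<ge> 1 \<and> delta_plus g n \<subseteq> {0..<\<iota>}))"

section \<open>The class of maps\<close>

definition C2_on :: "(real \<Rightarrow> real) \<Rightarrow> real set \<Rightarrow> bool" where
  "C2_on f S \<longleftrightarrow>
     (\<exists>f' f''. (\<forall>x\<in>S. (f has_real_derivative f' x) (at x)) \<and>
               (\<forall>x\<in>S. (f' has_real_derivative f'' x) (at x)) \<and> continuous_on S f'')"

definition C2_diffeo_incr :: "(real \<Rightarrow> real) \<Rightarrow> real set \<Rightarrow> real set \<Rightarrow> bool" where
  "C2_diffeo_incr f S T \<longleftrightarrow>
     bij_betw f S T \<and> C2_on f S \<and> C2_on (inv_into S f) T \<and> strict_mono_on S f"

definition A0 :: "(real \<Rightarrow> real) \<Rightarrow> bool" where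
  "A0 g \<longleftrightarrow>
     g \<in> {-1..1} \<rightarrow> {-1..1} \<and> (g 0 = 1 \<or> g 0 = -1) \<and>
     C2_diffeo_incr g {-1<..<0} {-1<..<1} \<and> C2_diffeo_incr g {0<..<1} {-1<..<1} \<and>
     {x \<in> {-1..1}. g x = x} = {-1, 1}"

text \<open>The three inclusions in the second line say that the neighbourhoods lie in the domain of the
  branch to which each formula refers; this is implicit in writing those formulas.\<close>

definition A1 :: "(real \<Rightarrow> real) \<Rightarrow> real \<Rightarrow> real \<Rightarrow> real \<Rightarrow> real \<Rightarrow> real
                    \<Rightarrow> real \<Rightarrow> real \<Rightarrow> real \<Rightarrow> real \<Rightarrow> bool" where
  "A1 g lm lp \<iota> km kp am ap bm bp \<longleftrightarrow>
     lm > 0 \<and> lp > 0 \<and> \<iota> > 0 \<and> km > 0 \<and> kp > 0 \<and> am > 0 \<and> ap > 0 \<and> bm > 0 \<and> bp > 0 \<and>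
     \<iota> \<le> 1 \<and> br_plus g ` {0..<\<iota>} \<subseteq> {-1..0} \<and> br_minus g ` {-\<iota><..0} \<subseteq> {0..1} \<and>
     (\<forall>x \<in> br_plus g ` {0..<\<iota>}. br_minus g x = x + bm * (1 + x) powr (1 + lm)) \<and>
     (\<forall>x \<in> br_minus g ` {-\<iota><..0}. br_plus g x = x - bp * (1 - x) powr (1 + lp)) \<and>
     (km \<noteq> 1 \<longrightarrow> (\<forall>x \<in> {-\<iota><..0}. br_minus g x = 1 - am * \<bar>x\<bar> powr km)) \<and>
     (kp \<noteq> 1 \<longrightarrow> (\<forall>x \<in> {0..<\<iota>}. br_plus g x = -1 + ap * x powr kp)) \<and>
     (km = 1 \<longrightarrow> (br_minus g has_real_derivative am) (at_left 0) \<and> am > 1 \<and>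
                 mono_on {-\<iota><..0} (br_minus g)) \<and>
     (kp = 1 \<longrightarrow> (br_plus g has_real_derivative ap) (at_right 0) \<and> ap > 1 \<and>
                 mono_on {0..<\<iota>} (br_plus g))"

definition A2 :: "(real \<Rightarrow> real) \<Rightarrow> real \<Rightarrow> bool" where
  "A2 g \<iota> \<longleftrightarrow>
     (\<exists>\<Lambda>>1.
        (\<forall>n x. 1 \<le> n \<and> n \<le> n_minus g \<iota> \<and> x \<in> delta_minus g n \<longrightarrow> deriv (g ^^ n) x > \<Lambda>) \<and>
        (\<forall>n x. 1 \<le> n \<and> n \<le> n_plus g \<iota> \<and> x \<in> delta_plus g n \<longrightarrow> deriv (g ^^ n) x > \<Lambda>))"

text \<open>\<open>Fstar \<alpha>\<close> consists of the maps of the class whose balanced exponent \<open>\<beta>\<close> is \<open>1/\<alpha>\<close>; the whole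
  class is the union over \<open>\<alpha>\<close>. The exponents in \<open>A1\<close> are determined by the germs of \<open>g\<close>, so
  each map of the class has exactly one \<open>\<alpha>\<close>.\<close>

definition Fstar :: "real \<Rightarrow> (real \<Rightarrow> real) set" where
  "Fstar \<alpha> = {g. \<exists>lm lp \<iota> km kp am ap bm bp \<beta>.
      A0 g \<and> A1 g lm lp \<iota> km kp am ap bm bp \<and> A2 g \<iota> \<and>
      lm * kp = \<beta> \<and> lp * km = \<beta> \<and> \<beta> \<ge> 1 \<and> \<alpha> = 1 / \<beta>}"

section \<open>The induced map and the natural measure\<close>

definition ret_dom :: "(real \<Rightarrow> real) \<Rightarrow> real set" where
  "ret_dom g = {u \<in> Delta_minus g 0. \<exists>n\<ge>1. (g ^^ n) u \<in> Delta_minus g 0}"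

definition ret_time :: "(real \<Rightarrow> real) \<Rightarrow> real \<Rightarrow> nat" where
  "ret_time g u = (LEAST n. n \<ge> 1 \<and> (g ^^ n) u \<in> Delta_minus g 0)"

definition ret_map :: "(real \<Rightarrow> real) \<Rightarrow> real \<Rightarrow> real" where
  "ret_map g u = (g ^^ ret_time g u) u"

text \<open>The return map is only defined on \<^term>\<open>ret_dom g\<close>, hence the explicit domain in the
  invariance condition; the choice \<open>A = Delta_minus g 0\<close> shows that this domain has full measure.\<close>

definition inv_acp :: "(real \<Rightarrow> real) \<Rightarrow> real measure \<Rightarrow> bool" where
  "inv_acp g \<mu> \<longleftrightarrow>
     prob_space \<mu> \<and> sets \<mu> = sets (restrict_space borel (Delta_minus g 0)) \<and>
     absolutely_continuous (restrict_space lborel (Delta_minus g 0)) \<mu> \<and>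
     (\<forall>A \<in> sets \<mu>. emeasure \<mu> {u \<in> ret_dom g. ret_map g u \<in> A} = emeasure \<mu> A)"

text \<open>Existence and uniqueness of this measure, and of the tail constants below, are known for all
  maps of the class.\<close>

definition mu_hat :: "(real \<Rightarrow> real) \<Rightarrow> real measure" where
  "mu_hat g = (THE \<mu>. inv_acp g \<mu>)"

definition tau_plus :: "(real \<Rightarrow> real) \<Rightarrow> real \<Rightarrow> nat" where
  "tau_plus g u = card {r. 1 \<le> r \<and> r \<le> ret_time g u \<and> (g ^^ r) u \<in> {0..1}}"

definition tau_minus :: "(real \<Rightarrow> real) \<Rightarrow> real \<Rightarrow> nat" where
  "tau_minus g u = card {r. 1 \<le> r \<and> r \<le> ret_time g u \<and> (g ^^ r) u \<in> {-1..0}}"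

definition tail_const :: "(real \<Rightarrow> real) \<Rightarrow> real \<Rightarrow> (real \<Rightarrow> nat) \<Rightarrow> real" where
  "tail_const g \<alpha> \<tau> = (THE C. C > 0 \<and>
     (\<lambda>n. measure (mu_hat g) {u \<in> ret_dom g. \<tau> u > n})
        \<sim>[sequentially] (\<lambda>n. C * real n powr (- \<alpha>)))"

definition p_star :: "(real \<Rightarrow> real) \<Rightarrow> real \<Rightarrow> real" where
  "p_star g \<alpha> = tail_const g \<alpha> (tau_plus g) /
     (tail_const g \<alpha> (tau_plus g) + tail_const g \<alpha> (tau_minus g))"

definition nu_star :: "(real \<Rightarrow> real) \<Rightarrow> real \<Rightarrow> real measure" where
  "nu_star g \<alpha> = lin_comb_measure I_borel {1, -1::real}
     (\<lambda>x. if x = 1 then p_star g \<alpha> else 1 - p_star g \<alpha>) (\<lambda>x. return I_borel x)"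

definition SNM :: "(real \<Rightarrow> real) \<Rightarrow> real \<Rightarrow> bool" where
  "SNM g \<alpha> \<longleftrightarrow>
     (\<forall>\<rho>. borel_prob_I \<rho> \<and> absolutely_continuous m_leb \<rho> \<longrightarrow>
        weak_star_conv (\<lambda>n. distr \<rho> I_borel (g ^^ n)) (nu_star g \<alpha>))"

section \<open>Sparse empirical measures\<close>

definition sparse_emp :: "(real \<Rightarrow> real) \<Rightarrow> (nat \<Rightarrow> nat) \<Rightarrow> nat \<Rightarrow> real \<Rightarrow> real measure" where
  "sparse_emp g a n x =
     lin_comb_measure I_borel {..<n} (\<lambda>_. 1 / real n) (\<lambda>k. return I_borel ((g ^^ a k) x))"

text \<open>The monadic bind is the integral of the measure-valued map \<open>x \<mapsto> sparse_emp g a n x\<close>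
  with respect to \<open>\<rho>\<close>.\<close>

definition annealed_emp ::
    "(real \<Rightarrow> real) \<Rightarrow> (nat \<Rightarrow> nat) \<Rightarrow> real measure \<Rightarrow> nat \<Rightarrow> real measure" where
  "annealed_emp g a \<rho> n = bind \<rho> (sparse_emp g a n)"

end

theory Submission
  imports Defs
begin

text \<open>Fix a continuous test function \<open>f\<close> and let \<open>c n\<close> be its
  integral against the push-forward of \<rho> by \<open>g ^^ n\<close>. By linearity, the integral
  of \<open>f\<close> against the annealed empirical measure is the mean of
  \<open>c (a 0), ..., c (a (n - 1))\<close>. SNM says that \<open>c\<close> converges to the
  integral against \<open>nu_star\<close>; the subsequence along the strictly increasing
  \<open>a\<close> has the same limit, and so have its Cesaro means (\<open>LIMSEQ_Cesaro\<close>).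
  The remaining work is measure theory: the iterates of \<open>g\<close> are measurable
  (\<open>A0_measurable\<close>), the bind defining the annealed measure is the finite average of
  push-forwards (\<open>annealed_emp_eq\<close>), and integration is linear over such averages
  (\<open>integral_lin_comb_measure_uniform\<close>).\<close>

lemma space_lin_comb_measure [simp]: "space (lin_comb_measure N J w M) = space N"
  by (simp add: lin_comb_measure_def space_measure_of_conv)

lemma sets_lin_comb_measure [simp, measurable_cong]:
  "sets (lin_comb_measure N J w M) = sets N"
  by (simp add: lin_comb_measure_def)

text \<open>\<open>measure_of\<close> takes the prescribed values only if the set function is
  countably additive; here this holds because a finite sum commutes with a series of nonnegative
  extended reals.\<close>

lemma emeasure_lin_comb_measure:
  fixes N :: "'a measure"
  assumes sets: "\<And>i. i \<in> J \<Longrightarrow> sets (M i) = sets N" and A: "A \<in> sets N"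
  shows "emeasure (lin_comb_measure N J w M) A = (\<Sum>i\<in>J. ennreal (w i) * emeasure (M i) A)"
  unfolding lin_comb_measure_def
proof (rule emeasure_measure_of_sigma)
  show "sigma_algebra (space N) (sets N)" by (rule sets.sigma_algebra_axioms)
  show "positive (sets N) (\<lambda>A. \<Sum>i\<in>J. ennreal (w i) * emeasure (M i) A)"
    by (simp add: positive_def)
  show "countably_additive (sets N) (\<lambda>A. \<Sum>i\<in>J. ennreal (w i) * emeasure (M i) A)"
  proof (rule countably_additiveI)
    fix B :: "nat \<Rightarrow> 'a set"
    assume B: "range B \<subseteq> sets N" "disjoint_family B"
    have "(\<Sum>n. \<Sum>i\<in>J. ennreal (w i) * emeasure (M i) (B n)) =
        (\<Sum>i\<in>J. \<Sum>n. ennreal (w i) * emeasure (M i) (B n))"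
      by (rule suminf_sum) simp
    also have "\<dots> = (\<Sum>i\<in>J. ennreal (w i) * emeasure (M i) (\<Union>n. B n))"
      using B sets by (intro sum.cong refl) (simp add: suminf_emeasure)
    finally show "(\<Sum>n. \<Sum>i\<in>J. ennreal (w i) * emeasure (M i) (B n)) =
        (\<Sum>i\<in>J. ennreal (w i) * emeasure (M i) (\<Union>n. B n))" .
  qed
qed (rule A)

text \<open>A uniform average is a two-stage experiment: draw an index uniformly from
  \<open>J\<close>, then sample from \<open>M i\<close>. This makes the integration rule for bind
  available. The condition on \<open>M\<close> covers all indices because a pmf, seen as a measure,
  lives on the whole type.\<close>

lemma lin_comb_measure_uniform:
  assumes J: "finite J" "J \<noteq> {}"
    and M: "\<And>i. M i \<in> space (subprob_algebra N)"
  shows "lin_comb_measure N J (\<lambda>_. 1 / real (card J)) M = measure_pmf (pmf_of_set J) \<bind> M"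
proof (rule measure_eqI)
  have sets: "sets (M i) = sets N" for i
    using M by (simp add: space_subprob_algebra)
  have meas: "M \<in> measure_pmf (pmf_of_set J) \<rightarrow>\<^sub>M subprob_algebra N"
    using M by simp
  show sets_eq: "sets (lin_comb_measure N J (\<lambda>_. 1 / real (card J)) M) =
      sets (measure_pmf (pmf_of_set J) \<bind> M)"
    by (simp add: sets_bind_measurable[OF meas])
  fix A assume "A \<in> sets (lin_comb_measure N J (\<lambda>_. 1 / real (card J)) M)"
  then have A: "A \<in> sets N" by simp
  have card: "card J > 0" using J by (simp add: card_gt_0_iff)
  have "emeasure (measure_pmf (pmf_of_set J) \<bind> M) A = (\<Sum>i\<in>J. emeasure (M i) A) / card J"
    using J A by (simp add: emeasure_bind[OF _ meas] nn_integral_pmf_of_set)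
  also have "\<dots> = (\<Sum>i\<in>J. ennreal (1 / real (card J)) * emeasure (M i) A)"
    using card
    by (simp add: sum_distrib_left[symmetric] divide_ennreal_def mult.commute[of "sum _ _"]
        inverse_ennreal[symmetric] inverse_eq_divide[symmetric] ennreal_of_nat_eq_real_of_nat)
  finally show "emeasure (lin_comb_measure N J (\<lambda>_. 1 / real (card J)) M) A =
      emeasure (measure_pmf (pmf_of_set J) \<bind> M) A"
    by (simp add: emeasure_lin_comb_measure[OF sets A])
qed

lemma integral_lin_comb_measure_uniform:
  fixes f :: "'a \<Rightarrow> real"
  assumes J: "finite J" "J \<noteq> {}"
    and M: "\<And>i. M i \<in> space (subprob_algebra N)"
    and f: "f \<in> borel_measurable N" "\<And>x. x \<in> space N \<Longrightarrow> \<bar>f x\<bar> \<le> B"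
  shows "(\<integral>x. f x \<partial>lin_comb_measure N J (\<lambda>_. 1 / real (card J)) M) =
      (\<Sum>i\<in>J. \<integral>x. f x \<partial>M i) / real (card J)"
proof -
  have meas: "M \<in> measure_pmf (pmf_of_set J) \<rightarrow>\<^sub>M subprob_algebra N"
    using M by simp
  \<comment> \<open>This is the bound \<open>B' = 1\<close> on the total masses that
    \<open>integral_bind\<close> asks for beside the bound \<open>B\<close> on
    \<open>f\<close>.\<close>
  have le1: "emeasure (M i) (space (M i)) \<le> ennreal 1" for i
    using M[of i] by (simp add: space_subprob_algebra subprob_space.emeasure_space_le_1)
  have "(\<integral>x. f x \<partial>(measure_pmf (pmf_of_set J) \<bind> M)) =
      (\<integral>i. (\<integral>x. f x \<partial>M i) \<partial>measure_pmf (pmf_of_set J))"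
    by (rule integral_bind[where K=N and B=B and B'=1])
      (use f le1 meas in \<open>auto intro!: measure_pmf.finite_measure AE_I2\<close>)
  then show ?thesis
    using J by (simp add: lin_comb_measure_uniform[OF J M] integral_pmf_of_set)
qed

text \<open>Both branches are continuous on open intervals, so only the points -1, 0 and 1 can be
  discontinuities, and a countable exceptional set does not affect Borel measurability.\<close>

lemma A0_measurable:
  assumes "A0 g"
  shows "g \<in> I_borel \<rightarrow>\<^sub>M I_borel"
proof (rule measurable_restrict_space2)
  show "g \<in> space I_borel \<rightarrow> {-1..1}"
    using assms by (simp add: A0_def space_restrict_space)
  have cont: "continuous_on {-1<..<0} g" "continuous_on {0<..<1} g"
    using assms unfolding A0_def C2_diffeo_incr_def C2_on_def
    by (meson DERIV_isCont continuous_at_imp_continuous_on)+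
  \<comment> \<open>The criterion for countably many exceptions concerns functions on the whole
    line, so \<open>g\<close> is extended by 0 outside the interval.\<close>
  let ?h = "\<lambda>x. if x \<in> {-1..1} then g x else 0"
  have *: "continuous_on {-1<..<0} ?h" "continuous_on {0<..<1} ?h"
    by (rule continuous_on_eq[OF cont(1)], simp, rule continuous_on_eq[OF cont(2)], simp)
  have **: "continuous_on {..<-1} ?h" "continuous_on {1<..} ?h"
    by (rule continuous_on_eq[of _ "\<lambda>_. 0"]; auto)+
  have "- {-1, 0, 1} = ({..<-1} \<union> {-1<..<0}) \<union> ({0<..<1} \<union> {1::real<..})"
    by auto
  moreover have "continuous_on (({..<-1} \<union> {-1<..<0}) \<union> ({0<..<1} \<union> {1<..})) ?h"
    by (intro continuous_on_open_Un * ** open_Un open_lessThan open_greaterThan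
        open_greaterThanLessThan)
  ultimately have "?h \<in> borel_measurable borel"
    by (intro borel_measurable_continuous_countable_exceptions[of "{-1, 0, 1}"]) auto
  then have "?h \<in> borel_measurable I_borel"
    by (rule measurable_restrict_space1)
  then show "g \<in> borel_measurable I_borel"
    by (subst measurable_cong[of _ _ ?h]) (auto simp: space_restrict_space)
qed

text \<open>Split the sum at an index \<open>N\<close> beyond which all errors are below
  \<open>e / 2\<close>: the initial block \<open>S\<close> is fixed and is swamped by
  \<open>n\<close>, while the rest contributes at most \<open>e / 2\<close> on average.\<close>

lemma LIMSEQ_Cesaro:
  fixes u :: "nat \<Rightarrow> real"
  assumes "u \<longlonglongrightarrow> L"
  shows "(\<lambda>n. (\<Sum>k<n. u k) / real n) \<longlonglongrightarrow> L"
proof (rule LIMSEQ_I)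
  fix e :: real assume e: "e > 0"
  obtain N where N: "\<And>k. k \<ge> N \<Longrightarrow> \<bar>u k - L\<bar> < e / 2"
    using LIMSEQ_D[OF assms, of "e / 2"] e by (auto simp: real_norm_def)
  define S where "S = (\<Sum>k<N. \<bar>u k - L\<bar>)"
  obtain K where K: "real K > 2 * S / e" using reals_Archimedean2 by blast
  \<comment> \<open>\<open>Suc N\<close> ensures both \<open>N \<le> n\<close> and
    \<open>n > 0\<close>; \<open>K\<close> makes \<open>S / n\<close> smaller than
    \<open>e / 2\<close>.\<close>
  have "norm ((\<Sum>k<n. u k) / real n - L) < e" if n: "n \<ge> max (Suc N) K" for n
  proof -
    have n0: "real n > 0" "N \<le> n" using n by auto
    have "2 * S / e < real n" using K n by linarith
    then have S: "S < real n * (e / 2)" using e by (simp add: field_simps)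
    have "(\<Sum>k<n. u k) - real n * L = (\<Sum>k<n. u k - L)"
      by (simp add: sum_subtractf)
    then have "\<bar>(\<Sum>k<n. u k) - real n * L\<bar> \<le> (\<Sum>k<n. \<bar>u k - L\<bar>)"
      by simp
    also have "\<dots> = S + (\<Sum>k=N..<n. \<bar>u k - L\<bar>)"
      using n0(2) by (simp add: S_def lessThan_atLeast0 sum.atLeastLessThan_concat)
    also have "(\<Sum>k=N..<n. \<bar>u k - L\<bar>) \<le> (\<Sum>k=N..<n. e / 2)"
      by (intro sum_mono) (use N in \<open>auto intro: less_imp_le\<close>)
    also have "\<dots> \<le> real n * (e / 2)"
      using e by (simp add: mult_right_mono)
    finally have "\<bar>(\<Sum>k<n. u k) - real n * L\<bar> < real n * e"
      using S by linarith
    moreover have "(\<Sum>k<n. u k) / real n - L = ((\<Sum>k<n. u k) - real n * L) / real n"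
      using n0 by (simp add: field_simps)
    ultimately show ?thesis
      using n0 by (simp add: abs_divide field_simps)
  qed
  then show "\<exists>M. \<forall>n\<ge>M. norm ((\<Sum>k<n. u k) / real n - L) < e" by blast
qed

text \<open>Evaluated on a set \<open>A\<close>, the bind is the integral over \<open>x\<close> of a
  weighted sum of indicators; exchanging sum and integral leaves the masses of \<open>A\<close>
  under the push-forwards.\<close>

lemma annealed_emp_eq:
  assumes g: "\<And>n. g ^^ n \<in> I_borel \<rightarrow>\<^sub>M I_borel" and \<rho>: "borel_prob_I \<rho>" and n: "n \<ge> 1"
  shows "annealed_emp g a \<rho> n =
      lin_comb_measure I_borel {..<n} (\<lambda>_. 1 / real n) (\<lambda>k. distr \<rho> I_borel (g ^^ a k))"
    (is "_ = ?R")
proof (rule measure_eqI)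
  interpret prob_space \<rho> using \<rho> by (simp add: borel_prob_I_def)
  have sets_\<rho>[measurable_cong]: "sets \<rho> = sets I_borel" using \<rho> by (simp add: borel_prob_I_def)
  have [measurable]: "g ^^ k \<in> \<rho> \<rightarrow>\<^sub>M I_borel" for k
    using g by (simp cong: measurable_cong_sets add: sets_\<rho>)
  have emp: "emeasure (sparse_emp g a n x) A =
      (\<Sum>k<n. ennreal (1 / real n) * indicator A ((g ^^ a k) x))"
    if "A \<in> sets I_borel" for x A
    unfolding sparse_emp_def using that by (subst emeasure_lin_comb_measure) auto
  \<comment> \<open>The bind can be computed once \<open>sparse_emp\<close> is a measurable kernel
    of subprobabilities. Since \<open>n \<ge> 1\<close>, the \<open>n\<close> weights
    \<open>1 / real n\<close> add up to 1.\<close>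
  have meas: "sparse_emp g a n \<in> \<rho> \<rightarrow>\<^sub>M subprob_algebra I_borel"
  proof (rule measurable_subprob_algebra)
    fix A assume [measurable]: "A \<in> sets I_borel"
    show "(\<lambda>x. emeasure (sparse_emp g a n x) A) \<in> borel_measurable \<rho>"
      by (subst emp) measurable
  next
    fix x assume "x \<in> space \<rho>"
    then have "(g ^^ k) x \<in> space I_borel" for k
      by (rule measurable_space[rotated]) measurable
    then have "emeasure (sparse_emp g a n x) (space I_borel) = (\<Sum>k<n. ennreal (1 / real n))"
      by (subst emp[OF sets.top]) simp
    also have "\<dots> = 1"
      using n by (simp add: ennreal_of_nat_eq_real_of_nat ennreal_mult[symmetric])
    finally show "subprob_space (sparse_emp g a n x)"
      by (intro prob_space_imp_subprob_space prob_spaceI) (simp add: sparse_emp_def)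
  qed (simp add: sparse_emp_def)
  show "sets (annealed_emp g a \<rho> n) = sets ?R"
    by (simp add: annealed_emp_def sets_bind_measurable[OF meas] not_empty)
  fix A assume "A \<in> sets (annealed_emp g a \<rho> n)"
  then have A [measurable]: "A \<in> sets I_borel"
    by (simp add: annealed_emp_def sets_bind_measurable[OF meas] not_empty)
  have ind: "(\<integral>\<^sup>+x. indicator A ((g ^^ k) x) \<partial>\<rho>) = emeasure (distr \<rho> I_borel (g ^^ k)) A" for k
    by (simp flip: nn_integral_indicator add: nn_integral_distr)
  have "emeasure (annealed_emp g a \<rho> n) A =
      (\<integral>\<^sup>+x. (\<Sum>k<n. ennreal (1 / real n) * indicator A ((g ^^ a k) x)) \<partial>\<rho>)"
    by (simp add: annealed_emp_def emeasure_bind[OF not_empty meas A] emp[OF A])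
  also have "\<dots> = (\<Sum>k<n. ennreal (1 / real n) * emeasure (distr \<rho> I_borel (g ^^ a k)) A)"
    by (subst nn_integral_sum) (auto simp: nn_integral_cmult ind)
  finally show "emeasure (annealed_emp g a \<rho> n) A = emeasure ?R A"
    by (simp add: emeasure_lin_comb_measure A)
qed

theorem theorem4p12:
  fixes g :: "real \<Rightarrow> real" and \<alpha> :: real and a :: "nat \<Rightarrow> nat" and \<rho> :: "real measure"
  assumes "g \<in> Fstar \<alpha>"
    and "SNM g \<alpha>"
    and "strict_mono a"
    and "borel_prob_I \<rho>"
    and "absolutely_continuous m_leb \<rho>"
  shows "(\<forall>n\<ge>1. annealed_emp g a \<rho> n =
            lin_comb_measure I_borel {..<n} (\<lambda>_. 1 / real n)
              (\<lambda>k. distr \<rho> I_borel (g ^^ a k))) \<and>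
         weak_star_conv (annealed_emp g a \<rho>) (nu_star g \<alpha>)"
proof
  have g: "g ^^ n \<in> I_borel \<rightarrow>\<^sub>M I_borel" for n
    using assms(1) by (intro measurable_compose_n A0_measurable) (auto simp: Fstar_def)
  show emp: "\<forall>n\<ge>1. annealed_emp g a \<rho> n =
      lin_comb_measure I_borel {..<n} (\<lambda>_. 1 / real n) (\<lambda>k. distr \<rho> I_borel (g ^^ a k))"
    using annealed_emp_eq[OF g assms(4)] by blast
  interpret prob_space \<rho> using assms(4) by (simp add: borel_prob_I_def)
  have "g ^^ n \<in> \<rho> \<rightarrow>\<^sub>M I_borel" for n
    using g assms(4) by (simp cong: measurable_cong_sets add: borel_prob_I_def)
  then have M: "distr \<rho> I_borel (g ^^ n) \<in> space (subprob_algebra I_borel)" for n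
    by (simp add: space_subprob_algebra prob_space_imp_subprob_space prob_space_distr)
  show "weak_star_conv (annealed_emp g a \<rho>) (nu_star g \<alpha>)"
    unfolding weak_star_conv_def
  proof (intro allI impI)
    fix f :: "real \<Rightarrow> real" assume f: "continuous_on {-1..1} f"
    \<comment> \<open>Continuity is given on the compact interval only, which is the space of all
      measures involved, so a bound there suffices.\<close>
    obtain B where B: "\<And>x. x \<in> {-1..1} \<Longrightarrow> \<bar>f x\<bar> \<le> B"
      using compact_imp_bounded[OF compact_continuous_image[OF f compact_Icc]]
      unfolding bounded_iff real_norm_def by blast
    have "(\<lambda>n. \<integral>x. f x \<partial>distr \<rho> I_borel (g ^^ n)) \<longlonglongrightarrow> (\<integral>x. f x \<partial>nu_star g \<alpha>)"
      using assms f by (auto simp: SNM_def weak_star_conv_def)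
    from LIMSEQ_Cesaro[OF LIMSEQ_subseq_LIMSEQ[OF this assms(3)]]
    have "(\<lambda>n. (\<Sum>k<n. \<integral>x. f x \<partial>distr \<rho> I_borel (g ^^ a k)) / real n)
        \<longlonglongrightarrow> (\<integral>x. f x \<partial>nu_star g \<alpha>)"
      by (simp add: o_def)
    moreover have "(\<integral>x. f x \<partial>annealed_emp g a \<rho> n) =
        (\<Sum>k<n. \<integral>x. f x \<partial>distr \<rho> I_borel (g ^^ a k)) / real n" if "n \<ge> 1" for n
      using integral_lin_comb_measure_uniform[of "{..<n}" "\<lambda>k. distr \<rho> I_borel (g ^^ a k)"
          I_borel f B] that M B emp borel_measurable_continuous_on_restrict[OF f]
      by (simp add: space_restrict_space lessThan_empty_iff)
    \<comment> \<open>At \<open>n = 0\<close> the averaging formula is not at hand, so the two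
      sequences are identified from 1 on.\<close>
    ultimately show "(\<lambda>n. \<integral>x. f x \<partial>annealed_emp g a \<rho> n) \<longlonglongrightarrow> (\<integral>x. f x \<partial>nu_star g \<alpha>)"
      by (elim Lim_transform_eventually) (auto intro!: eventually_sequentiallyI[of 1])
  qed
qed

end
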